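(* Let $n\in\mathbb N$ and let $Q_n(x):=\int_0^x q_n'(t)\,q_{n-1}(t)\,dt$ for $x\in[0,1]$. Then: (a) $q_n=h_n\circ q_{n-1}\colon[0,1]\to[0,1]$ is bijective and continuously differentiable, with $q_n(0)=n\bmod 2\in\{0,1\}$ and $q_n(1)-q_n(0)=(-1)^n$; (b) $\kappa_n=(-1)^nQ_n(1)$, and $q_{n+1}=q_{n+1}(0)-\frac1{\kappa_n}Q_n$ on $[0,1]$; (c) $\kappa_n\in\mathbb Q$ and $q_n\in\mathbb Q[X]$, with $v_X(q_n-q_n(0))=2^{\lfloor n/2\rfloor}$ and $\deg q_n=F_{n+1}$; moreover, there exists $d_n\in\mathbb N$ such that $d_n\cdot(q_n-q_n(0))\in\mathbb Z[X]$ is primitive. For $n=0$, the following hold: $q_0\colon[0,1]\to[0,1]$ is bijective and continuously differentiable with $q_0(0)=0$ and $q_0(1)-q_0(0)=1$; $\kappa_0\in\mathbb Q$ and $q_0\in\mathbb Q[X]$ with $v_X(q_0-q_0(0))=1$ and $\deg q_0=F_1=1$; and there exists $d_0\in\mathbb N$ such that $d_0\cdot(q_0-q_0(0))\in\mathbb Z[X]$ is primitive.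
   Context: $\mathbb N=\{1,2,3,\dots\}$ and $\mathbb N_0=\mathbb N\cup\{0\}$. Let $\mathcal E$ be the set of decreasing (in the weak sense, i.e. non-increasing) functions $g\colon[0,1]\to[0,1]$ with $g(0)=1$ and $\int_0^1 g(x)\,dx>0$. For $g\in\mathcal E$, the pseudo-inverse $g^*\in\mathcal E$ is defined by $g^*(y):=\sup g^{-1}([y,1])=\sup\{x\in[0,1]: g(x)\ge y\}$ for $y\in[0,1]$; it equals the compositional inverse $g^{-1}$ if $g$ is bijective. The operator $T\colon\mathcal E\to\mathcal E$ is defined by $$(Tg)(x):=\frac{\int_x^1 g^*(y)\,dy}{\int_0^1 g(y)\,dy}\quad\text{for } g\in\mathcal E,\ x\in[0,1].$$ Let $h_0\in\mathcal E$ be the constant function $1$ on $[0,1]$, and let $h_n:=T^nh_0$ for $n\in\mathbb N$ (the $n$-fold application of $T$). It is known that each $h_n$ with $n\ge1$ is a strictly decreasing convex bijection $[0,1]\to[0,1]$. Put $\kappa_n:=\int_0^1h_n(x)\,dx$ for $n\in\mathbb N_0$. Define $q_n:=h_n\circ h_{n-1}\circ\cdots\circ h_1\colon[0,1]\to[0,1]$ for $n\in\mathbb N_0$, where the empty composition is $q_0=\mathrm{id}_{[0,1]}$. The indeterminate $X$ is identified with $\mathrm{id}_{[0,1]}$, so that polynomials in $\mathbb R[X]$ are identified with the corresponding polynomial functions on $[0,1]$; thus "$q_n\in\mathbb Q[X]$" means that the function $q_n$ is the restriction to $[0,1]$ of a polynomial with rational coefficients. $v_X\colon\mathbb R[X]\to\mathbb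 N_0\cup\{\infty\}$ is the $X$-adic valuation ($v_X(p)$ is the largest $k$ such that $X^k$ divides $p$, and $v_X(0)=\infty$), and $\deg$ is the usual degree. A polynomial in $\mathbb Z[X]$ is primitive if the greatest common divisor of its coefficients is $1$. $(F_0,F_1,F_2,\dots)=(0,1,1,2,3,5,8,13,\dots)$ is the Fibonacci sequence, given by $F_0=0$, $F_1=1$, $F_{n+2}=F_{n+1}+F_n$. *)

theory Defs
  imports "HOL-Analysis.Analysis" "HOL-Computational_Algebra.Computational_Algebra"
    "HOL-Number_Theory.Fib"
begin

text \<open>A function on \<open>[0,1]\<close> is a total function on the reals of which only the values on
  \<open>{0..1}\<close> matter: for \<open>x\<close> in \<open>{0..1}\<close>, \<open>T_op g x\<close> depends on \<open>g\<close> only through its values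
  on \<open>{0..1}\<close>.\<close>

definition pseudo_inv :: "(real \<Rightarrow> real) \<Rightarrow> real \<Rightarrow> real" where
  "pseudo_inv g y = Sup {x \<in> {0..1}. g x \<ge> y}"

definition T_op :: "(real \<Rightarrow> real) \<Rightarrow> real \<Rightarrow> real" where
  "T_op g x = integral {x..1} (pseudo_inv g) / integral {0..1} g"

definition h_fun :: "nat \<Rightarrow> real \<Rightarrow> real" where
  "h_fun n = (T_op ^^ n) (\<lambda>_. 1)"

definition kappa :: "nat \<Rightarrow> real" where
  "kappa n = integral {0..1} (h_fun n)"

text \<open>The fold applies \<open>h_fun 1\<close> first and \<open>h_fun n\<close> last; it is the identity for \<open>n = 0\<close>.\<close>

definition q_fun :: "nat \<Rightarrow> real \<Rightarrow> real" where
  "q_fun n = fold h_fun [1..<Suc n]"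

text \<open>The derivative of a function on \<open>[0,1]\<close>: one-sided at the end points. This is why
  \<open>deriv\<close> and \<open>C1_differentiable_on\<close> (which are two-sided) are not used.\<close>

definition deriv01 :: "(real \<Rightarrow> real) \<Rightarrow> real \<Rightarrow> real" where
  "deriv01 f t = vector_derivative f (at t within {0..1})"

definition cont_diff01 :: "(real \<Rightarrow> real) \<Rightarrow> bool" where
  "cont_diff01 f \<longleftrightarrow> f differentiable_on {0..1} \<and> continuous_on {0..1} (deriv01 f)"

text \<open>Used for \<open>n \<ge> 1\<close> only.\<close>

definition Q_fun :: "nat \<Rightarrow> real \<Rightarrow> real" where
  "Q_fun n x = integral {0..x} (\<lambda>t. deriv01 (q_fun n) t * q_fun (n - 1) t)"

text \<open>\<open>order 0 p\<close> is the largest \<open>k\<close> such that \<open>[:0, 1:] ^ k\<close> divides \<open>p\<close>, and is junk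
  for \<open>p = 0\<close>.\<close>

definition v_X :: "real poly \<Rightarrow> enat" where
  "v_X p = (if p = 0 then \<infinity> else enat (order 0 p))"

text \<open>The real polynomial \<open>p\<close> lies in \<open>\<int>[X]\<close> and is primitive there.\<close>

definition primitive_int_poly :: "real poly \<Rightarrow> bool" where
  "primitive_int_poly p \<longleftrightarrow> (\<exists>r :: int poly. p = map_poly of_int r \<and> content r = 1)"

text \<open>The polynomial \<open>p\<close> is identified with the function \<open>f\<close> on \<open>[0,1]\<close>; it is determined by
  \<open>f\<close>, as \<open>[0,1]\<close> is infinite.\<close>

definition represents01 :: "real poly \<Rightarrow> (real \<Rightarrow> real) \<Rightarrow> bool" where
  "represents01 p f \<longleftrightarrow> (\<forall>x\<in>{0..1}. f x = poly p x)"

end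

theory Submission
  imports Defs
begin

text \<open>
  The functions \<open>q\<^sub>n\<close> are polynomials although most \<open>h\<^sub>n\<close> are not, because composing with \<open>q\<^sub>n\<close>
  removes the inverse from the definition of \<open>T\<close>. By definition,
  \<open>q\<^sub>n\<^sub>+\<^sub>1(x) = h\<^sub>n\<^sub>+\<^sub>1(q\<^sub>n(x))\<close> is \<open>1/\<kappa>\<^sub>n\<close> times the integral of \<open>h\<^sub>n\<^sup>*\<close> over \<open>[q\<^sub>n(x), 1]\<close>. Since
  \<open>q\<^sub>n = h\<^sub>n \<circ> q\<^sub>n\<^sub>-\<^sub>1\<close>, the substitution \<open>y = q\<^sub>n(t)\<close> turns \<open>h\<^sub>n\<^sup>*(y)\<close> into \<open>q\<^sub>n\<^sub>-\<^sub>1(t)\<close>, and the integrand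
  becomes \<open>q'\<^sub>n q\<^sub>n\<^sub>-\<^sub>1\<close>. In the same way, \<open>y = q\<^sub>n\<^sub>-\<^sub>1(t)\<close> turns \<open>\<kappa>\<^sub>n\<close> into \<open>\<plusminus>1\<close> times the integral of
  \<open>q'\<^sub>n\<^sub>-\<^sub>1 q\<^sub>n\<close> over \<open>[0,1]\<close>, which integration by parts relates to \<open>Q\<^sub>n(1)\<close>; the boundary terms
  vanish because one of \<open>q\<^sub>n\<^sub>-\<^sub>1\<close>, \<open>q\<^sub>n\<close> is zero at either end point.

  So the proof works with the polynomials \<open>qpoly n\<close> that satisfy the resulting recursion, and derives
  from it everything that does not mention \<open>h\<^sub>n\<close>. The substitutions need \<open>q\<^sub>n\<close> to be a bijection
  of \<open>[0,1]\<close>. This follows from the sign of the derivative, which is \<open>(-1)\<^sup>n\<close> on \<open>(0,1)\<close>: by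
  \<open>q'\<^sub>n\<^sub>+\<^sub>1 = - q'\<^sub>n q\<^sub>n\<^sub>-\<^sub>1 / \<kappa>\<^sub>n\<close> it changes in every step (lemma \<open>alternating_qpoly\<close>). The same formula
  gives rationality, the degree as a Fibonacci number and the valuation at \<open>0\<close>. Lemma \<open>T_op_factor\<close>
  then identifies \<open>h\<^sub>n \<circ> qpoly (n - 1)\<close> with \<open>qpoly n\<close> by induction, starting from
  \<open>h\<^sub>1(x) = 1 - x\<close>.

  The factor \<open>d\<^sub>n\<close> exists because \<open>q\<^sub>n - q\<^sub>n(0)\<close> has the value \<open>\<plusminus>1\<close> at \<open>1\<close>: the positive rational
  number \<open>c\<close> that makes a rational polynomial primitive is, up to sign, the value at \<open>1\<close> of that
  primitive polynomial, hence an integer.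
\<close>

section \<open>Antiderivatives of polynomials\<close>

definition poly_integral :: "real poly \<Rightarrow> real poly" where
  "poly_integral p = (\<Sum>i\<le>degree p. monom (coeff p i / real (Suc i)) (Suc i))"

lemma coeff_poly_integral:
  "coeff (poly_integral p) n = (case n of 0 \<Rightarrow> 0 | Suc m \<Rightarrow> coeff p m / real (Suc m))"
proof (cases n)
  case 0
  then show ?thesis by (simp add: poly_integral_def coeff_sum)
next
  case (Suc m)
  have "coeff (poly_integral p) (Suc m) =
      (\<Sum>i\<le>degree p. if m = i then coeff p m / real (Suc m) else 0)"
    unfolding poly_integral_def coeff_sum by (rule sum.cong) (auto simp: coeff_monom)
  also have "\<dots> = coeff p m / real (Suc m)"
    by (simp add: coeff_eq_0)
  finally show ?thesis by (simp add: Suc)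
qed

lemma pderiv_poly_integral [simp]: "pderiv (poly_integral p) = p"
  by (rule poly_eqI) (simp add: coeff_pderiv coeff_poly_integral)

lemma poly_poly_integral_0 [simp]: "poly (poly_integral p) 0 = 0"
  by (simp add: poly_0_coeff_0 coeff_poly_integral)

lemma poly_integral_add: "poly_integral (p + r) = poly_integral p + poly_integral r"
  by (rule poly_eqI) (simp add: coeff_poly_integral add_divide_distrib split: nat.split)

lemma poly_integral_pderiv: "poly_integral (pderiv p) = p - [:poly p 0:]"
  by (rule poly_eqI)
    (simp add: coeff_poly_integral coeff_pderiv poly_0_coeff_0 coeff_pCons split: nat.split)

lemma poly_integral_by_parts:
  "poly_integral (pderiv p * r) = p * r - [:poly p 0 * poly r 0:] - poly_integral (pderiv r * p)"
proof -
  have "poly_integral (pderiv p * r) + poly_integral (pderiv r * p) = poly_integral (pderiv (p * r))"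
    by (simp add: poly_integral_add [symmetric] pderiv_mult algebra_simps)
  also have "\<dots> = p * r - [:poly p 0 * poly r 0:]"
    by (simp add: poly_integral_pderiv)
  finally show ?thesis by (simp add: algebra_simps)
qed

lemma has_integral_poly:
  assumes "a \<le> b"
  shows "(poly p has_integral poly (poly_integral p) b - poly (poly_integral p) a) {a..b}"
proof (rule fundamental_theorem_of_calculus[OF assms])
  fix x
  have "DERIV (poly (poly_integral p)) x :> poly p x"
    using poly_DERIV[of "poly_integral p" x] by simp
  then show "(poly (poly_integral p) has_vector_derivative poly p x) (at x within {a..b})"
    using has_real_derivative_iff_has_vector_derivative has_vector_derivative_at_within by blast
qed

section \<open>Rational polynomials and their primitive multiples\<close>

lemma coeff_mult_Rats:
  fixes p r :: "real poly"
  assumes "\<And>i. coeff p i \<in> \<rat>" "\<And>i. coeff r i \<in> \<rat>"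
  shows "coeff (p * r) i \<in> \<rat>"
  unfolding coeff_mult by (intro Rats_sum Rats_mult assms)

lemma poly_Rats:
  fixes p :: "real poly"
  assumes "\<And>i. coeff p i \<in> \<rat>" "x \<in> \<rat>"
  shows "poly p x \<in> \<rat>"
  unfolding poly_altdef by (intro Rats_sum Rats_mult Rats_power assms)

lemma coeff_poly_integral_Rats:
  assumes "\<And>i. coeff p i \<in> \<rat>"
  shows "coeff (poly_integral p) i \<in> \<rat>"
  using assms by (auto simp: coeff_poly_integral split: nat.split intro!: Rats_divide Rats_add)

lemma coeff_pderiv_Rats:
  fixes p :: "real poly"
  assumes "\<And>i. coeff p i \<in> \<rat>"
  shows "coeff (pderiv p) i \<in> \<rat>"
  unfolding coeff_pderiv by (intro Rats_mult assms Rats_of_nat)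

lemma rational_poly_denominator:
  fixes p :: "real poly"
  assumes rat: "\<And>i. coeff p i \<in> \<rat>"
  obtains D :: nat and r :: "int poly" where "D \<ge> 1" "smult (real D) p = map_poly of_int r"
proof -
  have "\<exists>D::nat. D \<ge> 1 \<and> (\<forall>i<n. real D * coeff p i \<in> \<int>)" for n
  proof (induction n)
    case 0
    show ?case by (rule exI[of _ 1]) simp
  next
    case (Suc n)
    then obtain D :: nat where D: "D \<ge> 1" "\<And>i. i < n \<Longrightarrow> real D * coeff p i \<in> \<int>" by blast
    obtain a b :: int where ab: "b > 0" "coeff p n = of_int a / of_int b"
      using rat[of n] by (elim Rats_cases') auto
    have b: "real (nat b) = of_int b" using ab by simp
    have "real (D * nat b) * coeff p i \<in> \<int>" if "i < Suc n" for i
    proof (cases "i = n")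
      case True
      then have "real (D * nat b) * coeff p i = of_int (int D * a)" using ab b by simp
      then show ?thesis by (metis Ints_of_int)
    next
      case False
      then have "real (D * nat b) * coeff p i = of_int b * (real D * coeff p i)"
        by (simp only: of_nat_mult b mult_ac)
      moreover have "\<dots> \<in> \<int>"
        by (rule Ints_mult[OF Ints_of_int D(2)]) (use False that in simp)
      ultimately show ?thesis by (simp only:)
    qed
    moreover have "D * nat b \<ge> 1" using D(1) ab by simp
    ultimately show ?case by blast
  qed
  from this[of "Suc (degree p)"] obtain D :: nat
    where D: "D \<ge> 1" "\<And>i. i \<le> degree p \<Longrightarrow> real D * coeff p i \<in> \<int>" by (auto simp: less_Suc_eq_le)
  have "coeff (smult (real D) p) i \<in> \<int>" for i
    using D(2)[of i] by (cases "i \<le> degree p") (auto simp: coeff_eq_0)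
  then obtain r where "smult (real D) p = map_poly of_int r"
    by (rule intpolyE[of "smult (real D) p"])
  with D(1) that show ?thesis by blast
qed

lemma poly_map_poly_of_int_1: "poly (map_poly real_of_int r) 1 = real_of_int (poly r 1)"
  by (induction r) (simp_all add: map_poly_pCons)

text \<open>If \<open>D p = c r'\<close> with \<open>r'\<close> primitive and integers \<open>D, c > 0\<close>, then evaluation at \<open>1\<close> gives
  \<open>\<plusminus>D = c r'(1)\<close>. So \<open>c\<close> divides \<open>D\<close>, and \<open>r'\<close> is an integer multiple of \<open>p\<close>. Without a condition on
  the values of \<open>p\<close> the factor would only be rational, as for \<open>p = 2 X\<close>.\<close>

lemma primitive_multiple_exists:
  fixes p :: "real poly"
  assumes rat: "\<And>i. coeff p i \<in> \<rat>" and one: "\<bar>poly p 1\<bar> = 1"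
  shows "\<exists>d::nat. d \<ge> 1 \<and> primitive_int_poly (smult (real d) p)"
proof -
  obtain D :: nat and r :: "int poly"
    where D: "D \<ge> 1" "smult (real D) p = map_poly real_of_int r"
    using rational_poly_denominator[OF rat] by blast
  obtain r' where r': "r = smult (content r) r'" "content r' = 1"
    by (rule content_decompose)
  define c where "c = content r"
  have r_eq: "r = smult c r'" using r'(1) by (simp add: c_def)
  have "real_of_int (poly r 1) = real D * poly p 1"
    unfolding poly_map_poly_of_int_1[symmetric] D(2)[symmetric] by simp
  then have "\<bar>real_of_int (poly r 1)\<bar> = real D"
    using one by (simp add: abs_mult)
  then have abs_r: "\<bar>poly r 1\<bar> = int D" by linarith
  have "c dvd poly r 1" unfolding r_eq by simp
  then have "c dvd int D" using abs_r by (metis dvd_abs_iff)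
  moreover have "c > 0"
  proof -
    have "r \<noteq> 0" using abs_r D(1) by auto
    moreover have "normalize c = c" unfolding c_def by (rule normalize_content)
    ultimately show ?thesis unfolding c_def by (metis abs_ge_zero content_eq_zero_iff
        order_le_less normalize_int_def)
  qed
  ultimately obtain e where e: "int D = c * e" by (elim dvdE)
  then have "e > 0" using D(1) \<open>c > 0\<close> by (metis of_nat_0_less_iff zero_less_mult_pos
        less_le_trans zero_less_one)
  then obtain d where d: "e = int d" "d \<ge> 1"
    by (metis nonneg_int_cases less_imp_le int_one_le_iff_zero_less of_nat_1 of_nat_le_iff)
  have "smult (real d) p = map_poly real_of_int r'"
  proof (rule poly_eqI)
    fix i
    have "real D = real_of_int c * real d"
      using e d by (metis of_int_mult of_int_of_nat_eq)
    moreover have "real D * coeff p i = real_of_int c * real_of_int (coeff r' i)"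
      using arg_cong[OF D(2), of "\<lambda>p. coeff p i"] unfolding r_eq by (simp add: coeff_map_poly)
    ultimately show "coeff (smult (real d) p) i = coeff (map_poly real_of_int r') i"
      using \<open>c > 0\<close> by (simp add: coeff_map_poly)
  qed
  then show ?thesis
    using r'(2) d(2) unfolding primitive_int_poly_def by auto
qed

section \<open>Polynomial bijections of the unit interval\<close>

text \<open>The property of \<open>q\<^sub>n\<close> that is carried through the recursion: an increasing bijection of \<open>[0,1]\<close>
  for even \<open>n\<close>, a decreasing one for odd \<open>n\<close>. Monotonicity is required in the form of a sign of the
  derivative since this is what the recursion controls directly; the derivative may vanish at the
  end points.\<close>

definition alternating :: "nat \<Rightarrow> real poly \<Rightarrow> bool" where
  "alternating n p \<longleftrightarrow> poly p 0 = real (n mod 2) \<and> poly p 1 = 1 - real (n mod 2) \<and>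
     (\<forall>x\<in>{0<..<1}. 0 < (-1) ^ n * poly (pderiv p) x)"

lemma poly_less_if_pderiv_pos:
  fixes p :: "real poly"
  assumes pos: "\<And>x. x \<in> {0<..<1} \<Longrightarrow> 0 < s * poly (pderiv p) x"
    and xy: "0 \<le> x" "x < y" "y \<le> 1"
  shows "s * poly p x < s * poly p y"
proof (rule DERIV_pos_imp_increasing_open[OF xy(2)])
  fix z assume "x < z" "z < y"
  then have "0 < s * poly (pderiv p) z" using xy by (intro pos) auto
  moreover have "DERIV (\<lambda>x. s * poly p x) z :> s * poly (pderiv p) z"
    by (auto intro!: derivative_eq_intros)
  ultimately show "\<exists>d. DERIV (\<lambda>x. s * poly p x) z :> d \<and> d > 0" by blast
qed (intro continuous_intros)

lemma alternating_less_iff: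
  assumes "alternating n p" "x \<in> {0..1}" "y \<in> {0..1}"
  shows "(-1) ^ n * poly p x < (-1) ^ n * poly p y \<longleftrightarrow> x < y"
proof -
  have less: "(-1) ^ n * poly p x < (-1) ^ n * poly p y" if "0 \<le> x" "x < y" "y \<le> 1" for x y
    using assms(1) that unfolding alternating_def by (intro poly_less_if_pderiv_pos[where s = "(-1) ^ n"]) auto
  show ?thesis
    using less[of x y] less[of y x] assms(2,3) by (cases x y rule: linorder_cases) auto
qed

lemma alternating_range:
  assumes alt: "alternating n p"
  shows "x \<in> {0..1} \<Longrightarrow> poly p x \<in> {0..1}" and "x \<in> {0<..<1} \<Longrightarrow> poly p x \<in> {0<..<1}"
proof -
  have ends: "poly p 0 = real (n mod 2)" "poly p 1 = 1 - real (n mod 2)"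
    using alt by (auto simp: alternating_def)
  show *: "poly p x \<in> {0<..<1}" if "x \<in> {0<..<1}" for x
    using alternating_less_iff[OF alt, of 0 x] alternating_less_iff[OF alt, of x 1] that ends
    by (cases "even n") (auto simp: mod2_eq_if)
  show "poly p x \<in> {0..1}" if "x \<in> {0..1}"
  proof -
    have "x = 0 \<or> x = 1 \<or> x \<in> {0<..<1}" using that by auto
    then show ?thesis
      using *[of x] ends by (elim disjE) (auto simp: mod2_eq_if)
  qed
qed

lemma alternating_bij:
  assumes alt: "alternating n p"
  shows "bij_betw (poly p) {0..1} {0..1}"
proof (rule bij_betw_imageI)
  show "inj_on (poly p) {0..1}"
  proof (rule inj_onI)
    fix x y assume "x \<in> {0..1}" "y \<in> {0..1}" "poly p x = poly p y"
    then show "x = y"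
      using alternating_less_iff[OF alt, of x y] alternating_less_iff[OF alt, of y x] by force
  qed
  have "poly p ` {0..1} \<supseteq> {0..1}"
  proof
    fix y :: real assume y: "y \<in> {0..1}"
    have cont: "continuous_on {0..1} (poly p)" by (intro continuous_intros)
    show "y \<in> poly p ` {0..1}"
    proof (cases "even n")
      case True
      then have "poly p 0 = 0" "poly p 1 = 1" using alt by (auto simp: alternating_def)
      then show ?thesis using IVT'[of "poly p" 0 y 1] y cont by force
    next
      case False
      then have "poly p 0 = 1" "poly p 1 = 0"
        using alt by (auto simp: alternating_def odd_iff_mod_2_eq_one)
      then show ?thesis using IVT2'[of "poly p" 1 y 0] y cont by force
    qed
  qed
  then show "poly p ` {0..1} = {0..1}" using alternating_range(1)[OF alt] by blast
qed

section \<open>The polynomial recursion\<close>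

text \<open>The last clause is \<open>q\<^sub>n\<^sub>+\<^sub>2 = q\<^sub>n\<^sub>+\<^sub>2(0) - Q\<^sub>n\<^sub>+\<^sub>1 / \<kappa>\<^sub>n\<^sub>+\<^sub>1\<close> with \<open>\<kappa>\<^sub>n\<^sub>+\<^sub>1 = (-1)\<^sup>n\<^sup>+\<^sup>1 Q\<^sub>n\<^sub>+\<^sub>1(1)\<close>.\<close>

fun qpoly :: "nat \<Rightarrow> real poly" where
  "qpoly 0 = [:0, 1:]"
| "qpoly (Suc 0) = [:1, -1:]"
| "qpoly (Suc (Suc n)) =
    (let Q = poly_integral (pderiv (qpoly (Suc n)) * qpoly n)
     in [:real (n mod 2):] - smult (1 / ((-1) ^ Suc n * poly Q 1)) Q)"

text \<open>The indices are shifted: \<open>Qpoly n\<close> is \<open>Q\<^sub>n\<^sub>+\<^sub>1\<close>, and \<open>qpoly_kappa n\<close> is \<open>\<kappa>\<^sub>n\<^sub>+\<^sub>1\<close>.\<close>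

definition Qpoly :: "nat \<Rightarrow> real poly" where
  "Qpoly n = poly_integral (pderiv (qpoly (Suc n)) * qpoly n)"

definition qpoly_kappa :: "nat \<Rightarrow> real" where
  "qpoly_kappa n = (-1) ^ Suc n * poly (Qpoly n) 1"

lemma qpoly_Suc_Suc:
  "qpoly (Suc (Suc n)) = [:real (n mod 2):] - smult (1 / qpoly_kappa n) (Qpoly n)"
  by (simp add: Qpoly_def qpoly_kappa_def Let_def)

declare qpoly.simps(3) [simp del]

lemma pderiv_Qpoly: "pderiv (Qpoly n) = pderiv (qpoly (Suc n)) * qpoly n"
  by (simp add: Qpoly_def)

lemma poly_Qpoly_0: "poly (Qpoly n) 0 = 0"
  by (simp add: Qpoly_def)

lemma pderiv_qpoly_Suc_Suc:
  "pderiv (qpoly (Suc (Suc n))) =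
     smult (- 1 / qpoly_kappa n) (pderiv (qpoly (Suc n)) * qpoly n)"
  unfolding qpoly_Suc_Suc by (simp add: pderiv_diff pderiv_smult pderiv_pCons pderiv_Qpoly)

text \<open>The integrand \<open>q'\<^sub>n\<^sub>+\<^sub>1 q\<^sub>n\<close> inherits the sign of its first factor, because the second one
  maps \<open>(0,1)\<close> into itself.\<close>

lemma pderiv_Qpoly_sign:
  assumes "alternating n (qpoly n)" "alternating (Suc n) (qpoly (Suc n))" "x \<in> {0<..<1}"
  shows "0 < (-1) ^ Suc n * poly (pderiv (Qpoly n)) x"
proof -
  have "0 < (-1) ^ Suc n * poly (pderiv (qpoly (Suc n))) x"
    using assms(2,3) unfolding alternating_def by blast
  moreover have "0 < poly (qpoly n) x"
    using alternating_range(2)[OF assms(1,3)] by simp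
  ultimately have "0 < ((-1) ^ Suc n * poly (pderiv (qpoly (Suc n))) x) * poly (qpoly n) x"
    by (rule mult_pos_pos)
  then show ?thesis by (simp add: pderiv_Qpoly mult.assoc)
qed

lemma qpoly_kappa_pos_if_alternating:
  assumes "alternating n (qpoly n)" "alternating (Suc n) (qpoly (Suc n))"
  shows "qpoly_kappa n > 0"
proof -
  have "(-1) ^ Suc n * poly (Qpoly n) 0 < (-1) ^ Suc n * poly (Qpoly n) 1"
    by (rule poly_less_if_pderiv_pos[OF pderiv_Qpoly_sign[OF assms]]) simp_all
  then show ?thesis by (simp add: poly_Qpoly_0 qpoly_kappa_def)
qed

lemma alternating_qpoly_Suc_Suc:
  assumes "alternating n (qpoly n)" "alternating (Suc n) (qpoly (Suc n))"
  shows "alternating (Suc (Suc n)) (qpoly (Suc (Suc n)))"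
  unfolding alternating_def
proof (intro conjI ballI)
  have kpos: "qpoly_kappa n > 0" using assms by (rule qpoly_kappa_pos_if_alternating)
  show "poly (qpoly (Suc (Suc n))) 0 = real (Suc (Suc n) mod 2)"
    unfolding qpoly_Suc_Suc by (simp add: poly_Qpoly_0)
  have "poly (Qpoly n) 1 = (-1) ^ Suc n * qpoly_kappa n"
    by (simp add: qpoly_kappa_def flip: power_mult_distrib)
  then have "poly (qpoly (Suc (Suc n))) 1 = real (n mod 2) + (-1) ^ n"
    unfolding qpoly_Suc_Suc using kpos by simp
  then show "poly (qpoly (Suc (Suc n))) 1 = 1 - real (Suc (Suc n) mod 2)"
    by (cases "even n") (auto simp: odd_iff_mod_2_eq_one)
  fix x :: real assume "x \<in> {0<..<1}"
  then have "0 < (-1) ^ Suc n * poly (pderiv (Qpoly n)) x / qpoly_kappa n"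
    using pderiv_Qpoly_sign[OF assms] kpos by (metis divide_pos_pos)
  then show "0 < (-1) ^ Suc (Suc n) * poly (pderiv (qpoly (Suc (Suc n)))) x"
    by (simp add: pderiv_qpoly_Suc_Suc pderiv_Qpoly)
qed

lemma alternating_qpoly: "alternating n (qpoly n)"
proof (induction n rule: qpoly.induct)
  case 1
  show ?case by (simp add: alternating_def pderiv_pCons)
next
  case 2
  show ?case by (simp add: alternating_def pderiv_pCons)
next
  case (3 n)
  then show ?case by (rule alternating_qpoly_Suc_Suc[rotated])
qed

lemma qpoly_kappa_pos: "qpoly_kappa n > 0"
  by (intro qpoly_kappa_pos_if_alternating alternating_qpoly)

text \<open>The boundary terms of the integration by parts vanish: at \<open>0\<close> and at \<open>1\<close>, one of two consecutive
  \<open>q\<^sub>n\<close> is zero.\<close>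

lemma qpoly_kappa_by_parts:
  "qpoly_kappa n = (-1) ^ n * poly (poly_integral (pderiv (qpoly n) * qpoly (Suc n))) 1"
proof -
  have ends: "poly (qpoly n) 0 = real (n mod 2)" "poly (qpoly n) 1 = 1 - real (n mod 2)"
    "poly (qpoly (Suc n)) 0 = real (Suc n mod 2)" "poly (qpoly (Suc n)) 1 = 1 - real (Suc n mod 2)"
    using alternating_qpoly[of n] alternating_qpoly[of "Suc n"] unfolding alternating_def by blast+
  have "poly (Qpoly n) 1 = - poly (poly_integral (pderiv (qpoly n) * qpoly (Suc n))) 1"
    unfolding Qpoly_def poly_integral_by_parts[of "qpoly (Suc n)" "qpoly n"]
    using ends by (simp add: mod2_eq_if)
  then show ?thesis by (simp add: qpoly_kappa_def)
qed

section \<open>Coefficients, degree and valuation\<close>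

lemma qpoly_Rats: "coeff (qpoly n) i \<in> \<rat>"
proof (induction n arbitrary: i rule: qpoly.induct)
  case 1
  show ?case by (auto simp: coeff_pCons split: nat.split)
next
  case 2
  show ?case by (auto simp: coeff_pCons split: nat.split)
next
  case (3 n)
  have Q: "coeff (Qpoly n) i \<in> \<rat>" for i
    unfolding Qpoly_def
    by (intro coeff_poly_integral_Rats coeff_mult_Rats coeff_pderiv_Rats 3)
  then have "qpoly_kappa n \<in> \<rat>"
    unfolding qpoly_kappa_def by (intro Rats_mult poly_Rats Rats_power) auto
  with Q show ?case
    unfolding qpoly_Suc_Suc coeff_diff coeff_smult
    by (intro Rats_diff Rats_mult Rats_divide) (auto simp: coeff_pCons split: nat.split)
qed

lemma qpoly_kappa_Rats: "qpoly_kappa n \<in> \<rat>"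
  unfolding qpoly_kappa_def Qpoly_def
  by (intro Rats_mult poly_Rats Rats_power coeff_poly_integral_Rats coeff_mult_Rats
      coeff_pderiv_Rats qpoly_Rats) auto

lemma pderiv_qpoly_nonzero: "pderiv (qpoly n) \<noteq> 0"
proof
  assume "pderiv (qpoly n) = 0"
  moreover have "0 < (-1) ^ n * poly (pderiv (qpoly n)) (1/2)"
    using alternating_qpoly[of n] unfolding alternating_def by simp
  ultimately show False by simp
qed

text \<open>By \<open>q'\<^sub>n\<^sub>+\<^sub>2 = - q'\<^sub>n\<^sub>+\<^sub>1 q\<^sub>n / \<kappa>\<^sub>n\<^sub>+\<^sub>1\<close>, the degrees satisfy the Fibonacci recursion.\<close>

lemma degree_qpoly: "degree (qpoly n) = fib (Suc n)"
proof (induction n rule: qpoly.induct)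
  case (3 n)
  have nz: "pderiv (qpoly k) \<noteq> 0" "qpoly k \<noteq> 0" "degree (qpoly k) > 0" for k
    using pderiv_qpoly_nonzero[of k] by (auto simp: pderiv_eq_0_iff)
  have "degree (pderiv (qpoly (Suc (Suc n)))) = degree (qpoly (Suc n)) - 1 + degree (qpoly n)"
    unfolding pderiv_qpoly_Suc_Suc
    using qpoly_kappa_pos[of n] nz by (simp add: degree_mult_eq degree_pderiv)
  then have "degree (qpoly (Suc (Suc n))) = degree (qpoly (Suc n)) + degree (qpoly n)"
    using nz(3)[of "Suc (Suc n)"] nz(3)[of "Suc n"] by (simp add: degree_pderiv)
  with 3 show ?case by simp
qed simp_all

text \<open>Let \<open>V n\<close> be the valuation of \<open>q\<^sub>n - q\<^sub>n(0)\<close>. The derivative formula gives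
  \<open>V (n+2) = V (n+1) + v\<^sub>X(q\<^sub>n)\<close>. For odd \<open>n\<close> the second summand is \<open>0\<close>, as \<open>q\<^sub>n(0) = 1\<close>. For even
  \<open>n\<close> it is \<open>V n\<close>, which equals \<open>V (n+1)\<close>, so that the valuation doubles in every second step.\<close>

lemma order_qpoly: "order 0 (qpoly n - [:poly (qpoly n) 0:]) = 2 ^ (n div 2)"
proof (induction n rule: qpoly.induct)
  case 1
  have "order 0 [:0, 1 :: real:] = Suc (order 0 (pderiv [:0, 1 :: real:]))"
    by (rule order_pderiv) simp_all
  also have "order 0 (pderiv [:0, 1 :: real:]) = 0"
    by (rule order_0I) (simp add: pderiv_pCons)
  finally show ?case by simp
next
  case 2
  have "order 0 [:0, -1 :: real:] = Suc (order 0 (pderiv [:0, -1 :: real:]))"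
    by (rule order_pderiv) simp_all
  also have "order 0 (pderiv [:0, -1 :: real:]) = 0"
    by (rule order_0I) (simp add: pderiv_pCons)
  finally show ?case by simp
next
  case (3 n)
  define V where "V k = order 0 (qpoly k - [:poly (qpoly k) 0:])" for k
  have V_pderiv: "V k = Suc (order 0 (pderiv (qpoly k)))" for k
  proof -
    have "qpoly k - [:poly (qpoly k) 0:] \<noteq> 0"
      using pderiv_qpoly_nonzero[of k] by (metis eq_iff_diff_eq_0 pderiv_singleton)
    then have "V k = Suc (order 0 (pderiv (qpoly k - [:poly (qpoly k) 0:])))"
      unfolding V_def by (intro order_pderiv) simp_all
    then show ?thesis by (simp add: pderiv_diff pderiv_pCons)
  qed
  have nz: "pderiv (qpoly (Suc n)) * qpoly n \<noteq> 0"
    using pderiv_qpoly_nonzero[of n] pderiv_qpoly_nonzero[of "Suc n"] by auto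
  have "order 0 (pderiv (qpoly (Suc (Suc n)))) = order 0 (pderiv (qpoly (Suc n)) * qpoly n)"
    unfolding pderiv_qpoly_Suc_Suc by (rule order_smult) (use qpoly_kappa_pos[of n] in simp)
  then have V: "V (Suc (Suc n)) = V (Suc n) + order 0 (qpoly n)"
    unfolding V_pderiv order_mult[OF nz] by simp
  have IH: "V (Suc n) = 2 ^ (Suc n div 2)" "V n = 2 ^ (n div 2)"
    using 3 by (simp_all add: V_def)
  have at0: "poly (qpoly n) 0 = real (n mod 2)"
    using alternating_qpoly[of n] by (simp add: alternating_def)
  have "V (Suc (Suc n)) = 2 ^ (Suc (Suc n) div 2)"
  proof (cases "even n")
    case True
    then have "order 0 (qpoly n) = V n" using at0 by (simp add: V_def)
    with V IH True show ?thesis by simp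
  next
    case False
    then have "order 0 (qpoly n) = 0"
      using at0 by (intro order_0I) (simp add: odd_iff_mod_2_eq_one)
    with V IH False show ?thesis by simp
  qed
  then show ?case by (simp add: V_def)
qed

section \<open>The operator T after a change of variables\<close>

text \<open>Functions like \<open>h\<^sub>n\<close> and \<open>h\<^sub>n\<^sup>*\<close> are known only through their composition with some \<open>q\<^sub>k\<close>.
  As \<open>p\<close> is a homeomorphism of \<open>[0,1]\<close>, continuity passes from \<open>g \<circ> p\<close> to \<open>g\<close>.\<close>

lemma continuous_on_factor:
  fixes p r g :: "real \<Rightarrow> real"
  assumes "continuous_on {0..1} p" "continuous_on {0..1} r" "bij_betw p {0..1} {0..1}"
    and "\<And>t. t \<in> {0..1} \<Longrightarrow> g (p t) = r t"
  shows "continuous_on {0..1} g"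
proof -
  have img: "p ` {0..1} = {0..1}" and inj: "inj_on p {0..1}"
    using assms(3) by (auto simp: bij_betw_def)
  have inv: "continuous_on {0..1} (the_inv_into {0..1} p)"
    using continuous_on_inv_into[OF assms(1) compact_Icc inj] by (simp add: img)
  have into: "the_inv_into {0..1} p y \<in> {0..1}" "p (the_inv_into {0..1} p y) = y"
    if "y \<in> {0..1}" for y
    using that img inj by (metis the_inv_into_into subset_refl, metis f_the_inv_into_f)
  have "continuous_on {0..1} (\<lambda>y. r (the_inv_into {0..1} p y))"
    by (rule continuous_on_compose2[OF assms(2) inv]) (use into in auto)
  then show ?thesis
    by (rule continuous_on_eq) (use into assms(4) in metis)
qed

text \<open>Substitution \<open>y = p(t)\<close>. The difference on the left is the oriented integral of \<open>g\<close> from \<open>p(a)\<close>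
  to \<open>p(b)\<close>, so that increasing and decreasing \<open>p\<close> are treated alike.\<close>

lemma integral_factor:
  fixes p r :: "real poly"
  assumes p: "bij_betw (poly p) {0..1} {0..1}"
    and g: "\<And>t. t \<in> {0..1} \<Longrightarrow> g (poly p t) = poly r t"
    and ab: "0 \<le> a" "a \<le> b" "b \<le> 1"
  shows "integral {poly p a..poly p b} g - integral {poly p b..poly p a} g =
    poly (poly_integral (pderiv p * r)) b - poly (poly_integral (pderiv p * r)) a"
proof -
  have cont: "continuous_on {0..1} g"
    by (rule continuous_on_factor[where p = "poly p" and r = "poly r"])
      (use p g in \<open>auto intro!: continuous_intros\<close>)
  have "((\<lambda>x. poly (pderiv p) x *\<^sub>R g (poly p x)) has_integral
      (integral {poly p a..poly p b} g - integral {poly p b..poly p a} g)) {a..b}"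
  proof (rule has_integral_substitution_general[where s = "{}" and c = 0 and d = 1])
    show "poly p ` {a..b} \<subseteq> {0..1}"
      using bij_betw_imp_surj_on[OF p] ab by (auto dest!: equalityD1)
  qed (use ab cont in \<open>auto intro!: continuous_intros DERIV_subset[OF poly_DERIV]\<close>)
  then have "(poly (pderiv p * r) has_integral
      (integral {poly p a..poly p b} g - integral {poly p b..poly p a} g)) {a..b}"
    by (rule has_integral_eq[rotated]) (use g ab in auto)
  with has_integral_poly[OF ab(2)] show ?thesis by (rule has_integral_unique[rotated])
qed

text \<open>The function \<open>g = r \<circ> p\<^sup>-\<^sup>1\<close> is decreasing, because \<open>p\<close> and \<open>r\<close> have opposite directions. So its
  pseudo-inverse is the inverse \<open>p \<circ> r\<^sup>-\<^sup>1\<close>.\<close>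

lemma pseudo_inv_swaps:
  assumes p: "alternating n p" and r: "alternating (Suc n) r"
    and g: "\<And>t. t \<in> {0..1} \<Longrightarrow> g (poly p t) = poly r t" and t: "t \<in> {0..1}"
  shows "pseudo_inv g (poly r t) = poly p t"
proof -
  have "{x \<in> {0..1}. g x \<ge> poly r t} = {0..poly p t}"
  proof (intro set_eqI)
    fix x
    show "x \<in> {x \<in> {0..1}. g x \<ge> poly r t} \<longleftrightarrow> x \<in> {0..poly p t}"
    proof (cases "x \<in> {0..1}")
      case True
      then obtain u where u: "u \<in> {0..1}" "x = poly p u"
        using bij_betw_imp_surj_on[OF alternating_bij[OF p]] by (metis imageE)
      have "poly r u < poly r t \<longleftrightarrow> poly p t < poly p u"
      proof (cases "even n")
        case True
        then show ?thesis
          using alternating_less_iff[OF p t u(1)] alternating_less_iff[OF r t u(1)] by simp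
      next
        case False
        then show ?thesis
          using alternating_less_iff[OF p u(1) t] alternating_less_iff[OF r u(1) t] by simp
      qed
      then have "poly r t \<le> poly r u \<longleftrightarrow> poly p u \<le> poly p t" by linarith
      then show ?thesis using True g[OF u(1)] by (simp add: u(2))
    next
      case False
      then show ?thesis using alternating_range(1)[OF p t] by auto
    qed
  qed
  then show ?thesis
    using alternating_range(1)[OF p t] by (simp add: pseudo_inv_def)
qed

lemma h_fun_Suc: "h_fun (Suc n) = T_op (h_fun n)"
  by (simp add: h_fun_def)

lemma h_fun_1:
  assumes "x \<in> {0..1}"
  shows "h_fun (Suc 0) x = 1 - x"
proof -
  have "pseudo_inv (\<lambda>_. 1) y = 1" if "y \<le> 1" for y
    using that cSup_atLeastAtMost[of 0 "1::real"]
    by (simp add: pseudo_inv_def atLeastAtMost_def atLeast_def atMost_def Int_def)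
  then have "integral {x..1} (pseudo_inv (\<lambda>_. 1)) = integral {x..1} (\<lambda>_. 1)"
    by (intro integral_cong) auto
  then show ?thesis using assms by (simp add: h_fun_def T_op_def)
qed

text \<open>Applied to \<open>g = h\<^sub>n\<^sub>+\<^sub>1\<close>, this computes \<open>\<kappa>\<^sub>n\<^sub>+\<^sub>1\<close>.\<close>

lemma integral_if_factor:
  assumes "\<And>t. t \<in> {0..1} \<Longrightarrow> g (poly (qpoly n) t) = poly (qpoly (Suc n)) t"
  shows "integral {0..1} g = qpoly_kappa n"
proof -
  have ends: "poly (qpoly n) 0 = real (n mod 2)" "poly (qpoly n) 1 = 1 - real (n mod 2)"
    using alternating_qpoly[of n] unfolding alternating_def by blast+
  show ?thesis
    unfolding qpoly_kappa_by_parts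
    using integral_factor[OF alternating_bij[OF alternating_qpoly] assms, of 0 1] ends
    by (cases "even n") (auto simp: odd_iff_mod_2_eq_one)
qed

text \<open>The induction step from \<open>q\<^sub>n\<^sub>+\<^sub>1 = h\<^sub>n\<^sub>+\<^sub>1 \<circ> q\<^sub>n\<close> to \<open>q\<^sub>n\<^sub>+\<^sub>2 = h\<^sub>n\<^sub>+\<^sub>2 \<circ> q\<^sub>n\<^sub>+\<^sub>1\<close>: the pseudo-inverse of
  \<open>g = h\<^sub>n\<^sub>+\<^sub>1\<close> becomes \<open>q\<^sub>n\<close> when \<open>y = q\<^sub>n\<^sub>+\<^sub>1(t)\<close> is substituted.\<close>

lemma T_op_factor:
  assumes g: "\<And>t. t \<in> {0..1} \<Longrightarrow> g (poly (qpoly n) t) = poly (qpoly (Suc n)) t"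
    and x: "x \<in> {0..1}"
  shows "T_op g (poly (qpoly (Suc n)) x) = poly (qpoly (Suc (Suc n))) x"
proof -
  note alt = alternating_qpoly[of "Suc n"]
  have ends: "poly (qpoly (Suc n)) 0 = real (Suc n mod 2)"
    "poly (qpoly (Suc n)) 1 = 1 - real (Suc n mod 2)"
    using alt unfolding alternating_def by blast+
  have G: "pseudo_inv g (poly (qpoly (Suc n)) t) = poly (qpoly n) t" if "t \<in> {0..1}" for t
    using pseudo_inv_swaps[OF alternating_qpoly alternating_qpoly g that] .
  note subst = integral_factor[OF alternating_bij[OF alt] G]
  have y: "poly (qpoly (Suc n)) x \<in> {0..1}" using alternating_range(1)[OF alt x] .
  have right: "integral {1..poly (qpoly (Suc n)) x} (pseudo_inv g) = 0"
    using y by (cases "poly (qpoly (Suc n)) x = 1") auto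
  \<comment> \<open>The point \<open>1\<close> is \<open>q\<^sub>n\<^sub>+\<^sub>1(0)\<close> or \<open>q\<^sub>n\<^sub>+\<^sub>1(1)\<close> according to the parity, so the integral pulls back
    to \<open>[0,x]\<close> with reversed orientation or to \<open>[x,1]\<close>. In the second case, the part over
    \<open>[0,1]\<close> contributes \<open>Q\<^sub>n\<^sub>+\<^sub>1(1) = \<kappa>\<^sub>n\<^sub>+\<^sub>1\<close>.\<close>
  have "integral {poly (qpoly (Suc n)) x..1} (pseudo_inv g) =
      qpoly_kappa n * real (n mod 2) - poly (Qpoly n) x"
  proof (cases "even n")
    case True
    then show ?thesis
      using right subst[of 0 x] x ends True by (simp add: Qpoly_def mod2_eq_if)
  next
    case False
    then show ?thesis
      using right subst[of x 1] x ends False by (simp add: Qpoly_def qpoly_kappa_def mod2_eq_if)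
  qed
  then show ?thesis
    using qpoly_kappa_pos[of n] integral_if_factor[of g n, OF g]
    unfolding T_op_def qpoly_Suc_Suc by (simp add: diff_divide_distrib)
qed

lemma h_fun_qpoly:
  "x \<in> {0..1} \<Longrightarrow> h_fun (Suc n) (poly (qpoly n) x) = poly (qpoly (Suc n)) x"
proof (induction n arbitrary: x)
  case 0
  then show ?case by (simp add: h_fun_1)
next
  case (Suc n)
  show ?case unfolding h_fun_Suc[of "Suc n"]
    by (rule T_op_factor[where g = "h_fun (Suc n)", OF Suc.IH Suc.prems])
qed

section \<open>The functions q, Q and the numbers kappa\<close>

lemma kappa_Suc: "kappa (Suc n) = qpoly_kappa n"
  unfolding kappa_def by (rule integral_if_factor[where g = "h_fun (Suc n)", OF h_fun_qpoly])

lemma q_fun_Suc: "q_fun (Suc n) x = h_fun (Suc n) (q_fun n x)"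
  by (simp add: q_fun_def)

lemma q_fun_qpoly: "x \<in> {0..1} \<Longrightarrow> q_fun n x = poly (qpoly n) x"
proof (induction n)
  case 0
  show ?case by (simp add: q_fun_def)
next
  case (Suc n)
  then show ?case by (simp add: q_fun_Suc h_fun_qpoly)
qed

lemma q_fun_has_derivative:
  assumes "t \<in> {0..1}"
  shows "(q_fun n has_vector_derivative poly (pderiv (qpoly n)) t) (at t within {0..1})"
proof (rule has_vector_derivative_transform[OF assms q_fun_qpoly])
  show "(poly (qpoly n) has_vector_derivative poly (pderiv (qpoly n)) t) (at t within {0..1})"
    using poly_DERIV has_real_derivative_iff_has_vector_derivative has_vector_derivative_at_within
    by blast
qed

lemma deriv01_q_fun: "t \<in> {0..1} \<Longrightarrow> deriv01 (q_fun n) t = poly (pderiv (qpoly n)) t"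
  unfolding deriv01_def
  by (rule vector_derivative_within_closed_interval[OF _ _ q_fun_has_derivative]) auto

lemma cont_diff01_q_fun: "cont_diff01 (q_fun n)"
  unfolding cont_diff01_def
proof
  show "q_fun n differentiable_on {0..1}"
    unfolding differentiable_on_def
    using q_fun_has_derivative differentiableI_vector by blast
  show "continuous_on {0..1} (deriv01 (q_fun n))"
    by (rule continuous_on_eq[of _ "poly (pderiv (qpoly n))"])
      (auto simp: deriv01_q_fun intro: continuous_intros)
qed

lemma Q_fun_Suc:
  assumes "x \<in> {0..1}"
  shows "Q_fun (Suc n) x = poly (Qpoly n) x"
proof -
  have "Q_fun (Suc n) x = integral {0..x} (poly (pderiv (qpoly (Suc n)) * qpoly n))"
    unfolding Q_fun_def
    by (rule integral_cong) (use assms in \<open>simp add: deriv01_q_fun q_fun_qpoly\<close>)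
  also have "\<dots> = poly (Qpoly n) x"
    using integral_unique[OF has_integral_poly[of 0 x]] assms by (simp add: Qpoly_def)
  finally show ?thesis .
qed

lemma bij_betw_q_fun: "bij_betw (q_fun n) {0..1} {0..1}"
  using alternating_bij[OF alternating_qpoly[of n]]
    bij_betw_cong[of "{0..1}" "q_fun n" "poly (qpoly n)" "{0..1}", OF q_fun_qpoly]
  by simp

lemma q_fun_0: "q_fun n 0 = real (n mod 2)" and q_fun_diff: "q_fun n 1 - q_fun n 0 = (-1) ^ n"
  using alternating_qpoly[of n]
  by (auto simp: q_fun_qpoly alternating_def mod2_eq_if)

lemma q_fun_polynomial:
  "\<exists>p :: real poly. represents01 p (q_fun n) \<and> (\<forall>i. coeff p i \<in> \<rat>) \<and>
     v_X (p - [:q_fun n 0:]) = enat (2 ^ (n div 2)) \<and>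
     degree p = fib (n + 1) \<and>
     (\<exists>d::nat. d \<ge> 1 \<and> primitive_int_poly (smult (real d) (p - [:q_fun n 0:])))"
proof (intro exI[of _ "qpoly n"] conjI allI)
  let ?p = "qpoly n - [:q_fun n 0:]"
  have at0: "q_fun n 0 = poly (qpoly n) 0" by (simp add: q_fun_qpoly)
  show "represents01 (qpoly n) (q_fun n)" by (simp add: represents01_def q_fun_qpoly)
  show "degree (qpoly n) = fib (n + 1)" by (simp add: degree_qpoly)
  have "?p \<noteq> 0"
    using pderiv_qpoly_nonzero[of n] by (metis eq_iff_diff_eq_0 pderiv_singleton)
  then show "v_X ?p = enat (2 ^ (n div 2))"
    by (simp add: v_X_def at0 order_qpoly)
  have "coeff ?p i \<in> \<rat>" for i
    unfolding coeff_diff q_fun_0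
    by (intro Rats_diff qpoly_Rats) (simp add: coeff_pCons split: nat.split)
  moreover have "\<bar>poly ?p 1\<bar> = 1"
    using q_fun_diff[of n] by (simp add: q_fun_qpoly)
  ultimately show "\<exists>d::nat. d \<ge> 1 \<and> primitive_int_poly (smult (real d) ?p)"
    by (rule primitive_multiple_exists)
qed (rule qpoly_Rats)

theorem theorem1:
  shows "(\<forall>n::nat. n \<ge> 1 \<longrightarrow>
      \<comment> \<open>(a)\<close>
      ((\<forall>x\<in>{0..1}. q_fun n x = h_fun n (q_fun (n - 1) x)) \<and>
       bij_betw (q_fun n) {0..1} {0..1} \<and>
       cont_diff01 (q_fun n) \<and>
       q_fun n 0 = real (n mod 2) \<and>
       q_fun n 1 - q_fun n 0 = (-1) ^ n) \<and>
      \<comment> \<open>(b)\<close>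
      (kappa n = (-1) ^ n * Q_fun n 1 \<and>
       (\<forall>x\<in>{0..1}. q_fun (n + 1) x = q_fun (n + 1) 0 - 1 / kappa n * Q_fun n x)) \<and>
      \<comment> \<open>(c)\<close>
      (kappa n \<in> \<rat> \<and>
       (\<exists>p :: real poly. represents01 p (q_fun n) \<and> (\<forall>i. coeff p i \<in> \<rat>) \<and>
          v_X (p - [:q_fun n 0:]) = enat (2 ^ (n div 2)) \<and>
          degree p = fib (n + 1) \<and>
          (\<exists>d::nat. d \<ge> 1 \<and> primitive_int_poly (smult (real d) (p - [:q_fun n 0:])))))) \<and>
    \<comment> \<open>the case n = 0\<close>
    (bij_betw (q_fun 0) {0..1} {0..1} \<and>
     cont_diff01 (q_fun 0) \<and>
     q_fun 0 0 = 0 \<and>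
     q_fun 0 1 - q_fun 0 0 = 1 \<and>
     kappa 0 \<in> \<rat> \<and>
     (\<exists>p :: real poly. represents01 p (q_fun 0) \<and> (\<forall>i. coeff p i \<in> \<rat>) \<and>
        v_X (p - [:q_fun 0 0:]) = 1 \<and>
        degree p = fib 1 \<and> fib 1 = 1 \<and>
        (\<exists>d::nat. d \<ge> 1 \<and> primitive_int_poly (smult (real d) (p - [:q_fun 0 0:])))))"
proof (intro conjI allI impI)
  fix n :: nat assume "n \<ge> 1"
  then obtain m where n: "n = Suc m" by (cases n) auto
  show "\<forall>x\<in>{0..1}. q_fun n x = h_fun n (q_fun (n - 1) x)"
    by (simp add: n q_fun_Suc)
  show "bij_betw (q_fun n) {0..1} {0..1}" "cont_diff01 (q_fun n)" "q_fun n 0 = real (n mod 2)"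
    "q_fun n 1 - q_fun n 0 = (-1) ^ n"
    by (rule bij_betw_q_fun cont_diff01_q_fun q_fun_0 q_fun_diff)+
  show "kappa n = (-1) ^ n * Q_fun n 1" "kappa n \<in> \<rat>"
    by (simp_all add: n kappa_Suc qpoly_kappa_Rats) (simp add: Q_fun_Suc qpoly_kappa_def)
  show "\<forall>x\<in>{0..1}. q_fun (n + 1) x = q_fun (n + 1) 0 - 1 / kappa n * Q_fun n x"
    unfolding q_fun_0[of "n + 1"] n kappa_Suc
    by (simp add: q_fun_qpoly qpoly_Suc_Suc Q_fun_Suc poly_Qpoly_0)
  show "\<exists>p :: real poly. represents01 p (q_fun n) \<and> (\<forall>i. coeff p i \<in> \<rat>) \<and>
      v_X (p - [:q_fun n 0:]) = enat (2 ^ (n div 2)) \<and> degree p = fib (n + 1) \<and>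
      (\<exists>d::nat. d \<ge> 1 \<and> primitive_int_poly (smult (real d) (p - [:q_fun n 0:])))"
    by (rule q_fun_polynomial)
next
  show "bij_betw (q_fun 0) {0..1} {0..1}" "cont_diff01 (q_fun 0)"
    by (rule bij_betw_q_fun cont_diff01_q_fun)+
  show "q_fun 0 0 = 0" "q_fun 0 1 - q_fun 0 0 = 1"
    using q_fun_0[of 0] q_fun_diff[of 0] by simp_all
  show "kappa 0 \<in> \<rat>" by (simp add: kappa_def h_fun_def)
  show "\<exists>p :: real poly. represents01 p (q_fun 0) \<and> (\<forall>i. coeff p i \<in> \<rat>) \<and>
      v_X (p - [:q_fun 0 0:]) = 1 \<and> degree p = fib 1 \<and> fib 1 = 1 \<and>
      (\<exists>d::nat. d \<ge> 1 \<and> primitive_int_poly (smult (real d) (p - [:q_fun 0 0:])))"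
    using q_fun_polynomial[of 0] by (simp add: one_enat_def)
qed

end
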